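(* Let $(G,[\cdot,\cdot],\alpha,\beta)$ be a BiHom-Lie algebra over $\mathbb{C}$ such that the maps $\alpha$ and $\beta$ are surjective, and let $k,l$ be non-negative integers. Then for any $\lambda,\mu,\gamma\in\mathbb{C}$ there exists $\delta\in\mathbb{C}$ such that the subspace $Der_{\alpha^k\beta^l}^{(\lambda,\mu,\gamma)}(G)$ is equal to one of the six following subspaces: 1) $Der_{\alpha^k\beta^l}^{(0,0,0)}(G)$; 2) $Der_{\alpha^k\beta^l}^{(1,0,0)}(G)$; 3) $Der_{\alpha^k\beta^l}^{(\delta,1,0)}(G)$; 4) $Der_{\alpha^k\beta^l}^{(\delta,1,1)}(G)$; 5) $Der_{\alpha^k\beta^l}^{(1,1,-1)}(G)$; 6) $Der_{\alpha^k\beta^l}^{(0,1,-1)}(G)$.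
   Context: A BiHom-Lie algebra over a field $\mathbb{K}$ is a $4$-tuple $(L,[\cdot,\cdot],\alpha,\beta)$, where $L$ is a $\mathbb{K}$-linear space, $\alpha,\beta\colon L\to L$ are linear maps and $[\cdot,\cdot]\colon L\times L\to L$ is a bilinear map such that, for all $x,y,z\in L$: $\alpha\circ\beta=\beta\circ\alpha$; $[\beta(x),\alpha(y)]=-[\beta(y),\alpha(x)]$ (skew-symmetry); and $[\beta^2(x),[\beta(y),\alpha(z)]]+[\beta^2(y),[\beta(z),\alpha(x)]]+[\beta^2(z),[\beta(x),\alpha(y)]]=0$ (BiHom-Jacobi identity). For a BiHom-Lie algebra $(L,[\cdot,\cdot],\alpha,\beta)$ over $\mathbb{C}$, let $\Omega=\{f\in End(L)\mid f\circ\alpha=\alpha\circ f,\ f\circ\beta=\beta\circ f\}$. For $\lambda,\mu,\gamma\in\mathbb{C}$ and non-negative integers $k,l$, $Der_{\alpha^k\beta^l}^{(\lambda,\mu,\gamma)}(L)$ denotes the set of all $d\in\Omega$ such that for all $x,y\in L$ $$\lambda\, d([x,y])=\mu\,[d(x),\alpha^k\beta^l(y)]+\gamma\,[\alpha^k\beta^l(x),d(y)].$$ Its elements are called $(\lambda,\mu,\gamma)$-$\alpha^k\beta^l$-derivations of $L$. *)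

theory Defs
  imports Complex_Main
begin

locale bihom_lie_algebra = vector_space scale
  for scale :: "'k::field \<Rightarrow> 'a::ab_group_add \<Rightarrow> 'a" +
  fixes bracket :: "'a \<Rightarrow> 'a \<Rightarrow> 'a"
    and \<alpha> \<beta> :: "'a \<Rightarrow> 'a"
  assumes linear_alpha: "Vector_Spaces.linear scale scale \<alpha>"
    and linear_beta: "Vector_Spaces.linear scale scale \<beta>"
    and bracket_linear_left: "Vector_Spaces.linear scale scale (\<lambda>x. bracket x y)"
    and bracket_linear_right: "Vector_Spaces.linear scale scale (\<lambda>y. bracket x y)"
    and alpha_beta_commute: "\<alpha> \<circ> \<beta> = \<beta> \<circ> \<alpha>"
    and bihom_skew: "bracket (\<beta> x) (\<alpha> y) = - bracket (\<beta> y) (\<alpha> x)"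
    and bihom_jacobi:
      "bracket ((\<beta> ^^ 2) x) (bracket (\<beta> y) (\<alpha> z))
       + bracket ((\<beta> ^^ 2) y) (bracket (\<beta> z) (\<alpha> x))
       + bracket ((\<beta> ^^ 2) z) (bracket (\<beta> x) (\<alpha> y)) = 0"

definition bihom_Omega ::
  "('k::field \<Rightarrow> 'a::ab_group_add \<Rightarrow> 'a) \<Rightarrow> ('a \<Rightarrow> 'a) \<Rightarrow> ('a \<Rightarrow> 'a) \<Rightarrow> ('a \<Rightarrow> 'a) set"
  where
  "bihom_Omega scale \<alpha> \<beta> =
     {f. Vector_Spaces.linear scale scale f \<and> f \<circ> \<alpha> = \<alpha> \<circ> f \<and> f \<circ> \<beta> = \<beta> \<circ> f}"

definition bihom_Der ::
  "('k::field \<Rightarrow> 'a::ab_group_add \<Rightarrow> 'a) \<Rightarrow> ('a \<Rightarrow> 'a \<Rightarrow> 'a) \<Rightarrow> ('a \<Rightarrow> 'a) \<Rightarrow> ('a \<Rightarrow> 'a)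
    \<Rightarrow> nat \<Rightarrow> nat \<Rightarrow> 'k \<times> 'k \<times> 'k \<Rightarrow> ('a \<Rightarrow> 'a) set"
  where
  "bihom_Der scale bracket \<alpha> \<beta> k l = (\<lambda>(lam, \<mu>, \<gamma>).
     {d \<in> bihom_Omega scale \<alpha> \<beta>. \<forall>x y.
        scale lam (d (bracket x y)) =
          scale \<mu> (bracket (d x) ((\<alpha> ^^ k \<circ> \<beta> ^^ l) y))
          + scale \<gamma> (bracket ((\<alpha> ^^ k \<circ> \<beta> ^^ l) x) (d y))})"

end

theory Submission
  imports Defs
begin

text \<open>
  Write \<open>\<phi>\<close> for \<open>\<alpha>\<^sup>k \<beta>\<^sup>l\<close>, and put \<open>B u v = [\<beta> u, \<alpha> v]\<close> and \<open>A u v = [\<beta> (d u), \<alpha> (\<phi> v)]\<close>.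
  Surjectivity of \<open>\<alpha>\<close> and \<open>\<beta>\<close> makes \<open>[\<beta> u, \<alpha> v]\<close> the general value of the bracket, and
  skew-symmetry then rewrites the second term of the derivation identity in terms of the first:
  \<open>d\<close> is a derivation of weight \<open>(lam, \<mu>, \<gamma>)\<close> if and only if
  \<open>lam d (B u v) = \<mu> A u v - \<gamma> A v u\<close> for all \<open>u\<close> and \<open>v\<close> (\<open>mem_Der_iff\<close>).

  Since \<open>B\<close> is skew-symmetric, adding this to its instance with \<open>u\<close> and \<open>v\<close> exchanged gives
  \<open>(\<mu> - \<gamma>) (A u v + A v u) = 0\<close>. Hence if \<open>\<mu> \<noteq> \<gamma>\<close>, then \<open>A\<close> is skew-symmetric, and the
  condition becomes \<open>lam d (B u v) = (\<mu> + \<gamma>) A u v\<close>: as long as \<open>\<mu> \<noteq> \<gamma>\<close>, only \<open>lam\<close> and the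
  sum \<open>\<mu> + \<gamma>\<close> matter (\<open>Der_eq_if_same_sum\<close>). Besides, a weight may be multiplied by any
  nonzero scalar (\<open>Der_rescale\<close>). These two moves bring every weight to one of the six
  normal forms, according to whether \<open>\<mu> = \<gamma>\<close>, \<open>\<mu> + \<gamma> = 0\<close> and \<open>lam = 0\<close>.
\<close>

lemma funpow_commute:
  assumes "\<And>x. f (g x) = g (f x)"
  shows "(f ^^ n) (g x) = g ((f ^^ n) x)"
  by (induction n) (simp_all add: assms)

context bihom_lie_algebra
begin

abbreviation Der :: "nat \<Rightarrow> nat \<Rightarrow> 'k \<times> 'k \<times> 'k \<Rightarrow> ('a \<Rightarrow> 'a) set" where
  "Der \<equiv> bihom_Der scale bracket \<alpha> \<beta>"

lemma Der_rescale:
  assumes "c \<noteq> 0"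
  shows "Der k l (c * lam, c * \<mu>, c * \<gamma>) = Der k l (lam, \<mu>, \<gamma>)"
proof -
  have "scale (c * lam) a = scale (c * \<mu>) b + scale (c * \<gamma>) e \<longleftrightarrow>
        scale lam a = scale \<mu> b + scale \<gamma> e" for a b e
    using assms scale_left_imp_eq[of c "scale lam a" "scale \<mu> b + scale \<gamma> e"]
    by (auto simp: scale_right_distrib simp flip: scale_scale)
  then show ?thesis by (simp add: bihom_Der_def)
qed

text \<open>
  Substituting \<open>x = \<beta> u\<close> and \<open>y = \<alpha> v\<close>, the factor \<open>[\<phi> x, d y]\<close> becomes
  \<open>[\<beta> (\<phi> u), \<alpha> (d v)]\<close>, because \<open>d\<close> and \<open>\<phi>\<close> commute with \<open>\<alpha>\<close> and \<open>\<beta>\<close>; skew-symmetry then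
  moves \<open>d\<close> into the first argument. Surjectivity is what makes this substitution lossless.
\<close>
lemma mem_Der_iff:
  fixes k l :: nat
  assumes "surj \<alpha>" "surj \<beta>" and d: "d \<in> bihom_Omega scale \<alpha> \<beta>"
  defines "\<phi> \<equiv> \<alpha> ^^ k \<circ> \<beta> ^^ l"
  shows "d \<in> Der k l (lam, \<mu>, \<gamma>) \<longleftrightarrow>
    (\<forall>u v. scale lam (d (bracket (\<beta> u) (\<alpha> v))) =
       scale \<mu> (bracket (\<beta> (d u)) (\<alpha> (\<phi> v))) - scale \<gamma> (bracket (\<beta> (d v)) (\<alpha> (\<phi> u))))"
proof -
  have dc: "d (\<alpha> x) = \<alpha> (d x)" "d (\<beta> x) = \<beta> (d x)" for x
    using d by (auto simp: bihom_Omega_def fun_eq_iff)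
  have ab: "\<alpha> (\<beta> x) = \<beta> (\<alpha> x)" for x
    using alpha_beta_commute by (simp add: fun_eq_iff)
  have \<phi>c: "\<phi> (\<alpha> x) = \<alpha> (\<phi> x)" "\<phi> (\<beta> x) = \<beta> (\<phi> x)" for x
    using funpow_commute[of \<alpha> \<alpha>] funpow_commute[of \<beta> \<alpha>] funpow_commute[of \<alpha> \<beta>]
      funpow_commute[of \<beta> \<beta>] by (simp_all add: \<phi>_def ab)
  have all: "(\<forall>x y. P x y) \<longleftrightarrow> (\<forall>u v. P (\<beta> u) (\<alpha> v))" for P
    using surj_f_inv_f[OF assms(1)] surj_f_inv_f[OF assms(2)] by metis
  have moved: "bracket (\<beta> (\<phi> u)) (\<alpha> (d v)) = - bracket (\<beta> (d v)) (\<alpha> (\<phi> u))" for u v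
    by (rule bihom_skew)
  have "d \<in> Der k l (lam, \<mu>, \<gamma>) \<longleftrightarrow>
    (\<forall>x y. scale lam (d (bracket x y)) =
       scale \<mu> (bracket (d x) (\<phi> y)) + scale \<gamma> (bracket (\<phi> x) (d y)))"
    using d by (simp add: bihom_Der_def \<phi>_def)
  also have "\<dots> \<longleftrightarrow>
    (\<forall>u v. scale lam (d (bracket (\<beta> u) (\<alpha> v))) =
       scale \<mu> (bracket (\<beta> (d u)) (\<alpha> (\<phi> v))) - scale \<gamma> (bracket (\<beta> (d v)) (\<alpha> (\<phi> u))))"
    by (subst all) (simp add: dc \<phi>c moved)
  finally show ?thesis .
qed

text \<open>
  For distinct weights the identity forces \<open>A\<close> (notation as at the top) to be skew-symmetric,
  and \<open>\<mu> A u v - \<gamma> A v u\<close> then depends on \<open>\<mu> + \<gamma>\<close> alone. The other pair of weights is kept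
  distinct in order that the inclusion can be reversed.
\<close>
lemma Der_eq_if_same_sum:
  assumes surj: "surj \<alpha>" "surj \<beta>"
    and "\<mu> \<noteq> \<gamma>" "\<mu>' \<noteq> \<gamma>'" "\<mu> + \<gamma> = \<mu>' + \<gamma>'"
  shows "Der k l (lam, \<mu>, \<gamma>) = Der k l (lam, \<mu>', \<gamma>')"
proof -
  have incl: "Der k l (lam, m, g) \<subseteq> Der k l (lam, m', g')"
    if neq: "m \<noteq> g" and sum_eq: "m + g = m' + g'" for m g m' g'
  proof
    fix d assume d: "d \<in> Der k l (lam, m, g)"
    then have Om: "d \<in> bihom_Omega scale \<alpha> \<beta>"
      by (simp add: bihom_Der_def)
    then interpret d: Vector_Spaces.linear scale scale d
      by (simp add: bihom_Omega_def)
    define A where "A u v = bracket (\<beta> (d u)) (\<alpha> ((\<alpha> ^^ k \<circ> \<beta> ^^ l) v))" for u v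
    define L where "L u v = scale lam (d (bracket (\<beta> u) (\<alpha> v)))" for u v
    have L: "L u v = scale m (A u v) - scale g (A v u)" for u v
      using d unfolding mem_Der_iff[OF surj Om] A_def L_def by blast
    have skew: "A v u = - A u v" for u v
    proof -
      have "L u v + L v u = 0"
        unfolding L_def by (subst bihom_skew) (simp add: d.neg)
      then have "scale (m - g) (A u v + A v u) = 0"
        unfolding L by (simp add: algebra_simps)
      then show ?thesis
        using neq by (simp add: eq_neg_iff_add_eq_0 add.commute)
    qed
    have "L u v = scale m' (A u v) - scale g' (A v u)" for u v
    proof -
      have "L u v = scale (m + g) (A u v)"
        unfolding L skew[of u v] by (simp add: scale_left_distrib)
      also have "\<dots> = scale m' (A u v) - scale g' (A v u)"
        unfolding sum_eq skew[of u v] by (simp add: scale_left_distrib)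
      finally show ?thesis .
    qed
    then show "d \<in> Der k l (lam, m', g')"
      unfolding mem_Der_iff[OF surj Om] A_def L_def by blast
  qed
  show ?thesis
    using incl[of \<mu> \<gamma> \<mu>' \<gamma>'] incl[of \<mu>' \<gamma>' \<mu> \<gamma>] assms(3-5) by simp
qed

end

theorem theorem3p5:
  fixes scale :: "complex \<Rightarrow> 'a::ab_group_add \<Rightarrow> 'a"
    and bracket :: "'a \<Rightarrow> 'a \<Rightarrow> 'a"
    and \<alpha> \<beta> :: "'a \<Rightarrow> 'a"
    and k l :: nat
    and lam \<mu> \<gamma> :: complex
  assumes "bihom_lie_algebra scale bracket \<alpha> \<beta>"
    and "surj \<alpha>"
    and "surj \<beta>"
  shows "\<exists>\<delta>::complex.
      bihom_Der scale bracket \<alpha> \<beta> k l (lam, \<mu>, \<gamma>) = bihom_Der scale bracket \<alpha> \<beta> k l (0, 0, 0)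
    \<or> bihom_Der scale bracket \<alpha> \<beta> k l (lam, \<mu>, \<gamma>) = bihom_Der scale bracket \<alpha> \<beta> k l (1, 0, 0)
    \<or> bihom_Der scale bracket \<alpha> \<beta> k l (lam, \<mu>, \<gamma>) = bihom_Der scale bracket \<alpha> \<beta> k l (\<delta>, 1, 0)
    \<or> bihom_Der scale bracket \<alpha> \<beta> k l (lam, \<mu>, \<gamma>) = bihom_Der scale bracket \<alpha> \<beta> k l (\<delta>, 1, 1)
    \<or> bihom_Der scale bracket \<alpha> \<beta> k l (lam, \<mu>, \<gamma>) = bihom_Der scale bracket \<alpha> \<beta> k l (1, 1, -1)
    \<or> bihom_Der scale bracket \<alpha> \<beta> k l (lam, \<mu>, \<gamma>) = bihom_Der scale bracket \<alpha> \<beta> k l (0, 1, -1)"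
proof -
  interpret bihom_lie_algebra scale bracket \<alpha> \<beta> by (rule assms(1))
  let ?D = "bihom_Der scale bracket \<alpha> \<beta> k l"
  note rescale = Der_rescale[of _ k l] and by_sum = Der_eq_if_same_sum[OF assms(2,3), of _ _ _ _ k l]
  consider (sym_zero) "\<mu> = \<gamma>" "\<gamma> = 0" | (sym) "\<mu> = \<gamma>" "\<gamma> \<noteq> 0"
    | (skew) "\<mu> \<noteq> \<gamma>" "\<mu> + \<gamma> = 0" | (generic) "\<mu> \<noteq> \<gamma>" "\<mu> + \<gamma> \<noteq> 0"
    by blast
  then show ?thesis
  proof cases
    case sym_zero
    then show ?thesis using rescale[of lam 1 0 0] by (cases "lam = 0") auto
  next
    case sym
    then have "?D (lam, \<mu>, \<gamma>) = ?D (lam / \<mu>, 1, 1)"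
      using rescale[of \<mu> "lam / \<mu>" 1 1] by simp
    then show ?thesis by blast
  next
    case skew
    show ?thesis
    proof (cases "lam = 0")
      case True
      then have "?D (lam, \<mu>, \<gamma>) = ?D (0, 1, -1)"
        using skew by_sum[of \<mu> \<gamma> 1 "-1" 0] by simp
      then show ?thesis by blast
    next
      case False
      \<comment> \<open>Any distinct pair with sum zero may replace \<open>(\<mu>, \<gamma>)\<close>; this choice makes the
        whole weight a multiple of \<open>(1, 1, -1)\<close>.\<close>
      have "?D (lam, \<mu>, \<gamma>) = ?D (lam, lam, - lam)"
        using skew False by_sum[of \<mu> \<gamma> lam "- lam" lam] by simp
      also have "\<dots> = ?D (1, 1, -1)"
        using False rescale[of lam 1 1 "-1"] by simp
      finally show ?thesis by blast
    qed
  next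
    case generic
    have "?D (lam, \<mu>, \<gamma>) = ?D (lam, \<mu> + \<gamma>, 0)"
      using generic by_sum[of \<mu> \<gamma> "\<mu> + \<gamma>" 0 lam] by simp
    also have "\<dots> = ?D (lam / (\<mu> + \<gamma>), 1, 0)"
      using generic(2) rescale[of "\<mu> + \<gamma>" "lam / (\<mu> + \<gamma>)" 1 0] by simp
    finally show ?thesis by blast
  qed
qed

end
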